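(* Let $\tau\colon\Gamma\to D(\Gamma)$ be the divisor theory of a semigroup $\Gamma$ and let $\alpha\colon\Gamma\to S$ be an embedding of $\Gamma$ into a free semigroup $S$ satisfying the following conditions: $( * )$ if for some $a,b\in\Gamma$ there exists $s\in S$ such that $\alpha(a)=\alpha(b)s$, then $s=\alpha(c)$ for some $c\in\Gamma$; $( ** )$ if all elements of some subset $A\subseteq\Gamma$ are coprime in $D(\Gamma)$, that is, the elements of $\tau(A)$ are not all divisible by one and the same non-unit element of $D(\Gamma)$, then all elements of $\alpha(A)\subseteq S$ are coprime in $S$ (in the same sense). Then there exists a unique embedding $\beta\colon D(\Gamma)\hookrightarrow S$ such that $\beta\circ\tau=\alpha$.
   Context: A semigroup means a commutative semigroup, written multiplicatively, with unit $e$, in which all elements different from $e$ are not invertible. "Non-unit element" means an element different from $e$. An embedding of semigroups is an injective homomorphism. A semigroup $S$ is free if there is a subset $P\subset S\setminus\{e\}$ such that each $s\in S\setminus\{e\}$ can be expressed as $s=p_1^{k_1}\cdots p_m^{k_m}$ with $p_i\in P$, $k_i\in\mathbb{N}$, uniquely up to the order of factors. The divisor theory of a semigroup $\Gamma$ is an embedding $\tau\colon\Gamma\hookrightarrow D$ into a free semigroup $D$ such that (i) if $a,b\in\Gamma$ and $\tau(a)=\tau(b)c_1$ for some $c_1\in D$, then $c_1=\tau(c)$ for some $c\in\Gamma$; (ii) if for $d_1,d_2\in D$ one has $\{a\in\Gamma\mid\exists\, d\in D:\tau(a)=dd_1\}=\{b\in\Gamma\mid\exists\, d\in D:\tau(b)=dd_2\}$,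 then $d_1=d_2$. If a semigroup $\Gamma$ has a divisor theory, it is unique up to isomorphism, and $D$ is denoted $D(\Gamma)$. *)

theory Defs
  imports "HOL-Algebra.Divisibility" "HOL-Algebra.FiniteProduct"
begin

locale reduced_semigroup = comm_monoid +
  assumes not_invertible: "\<lbrakk>x \<in> carrier G; x \<noteq> \<one>\<rbrakk> \<Longrightarrow> x \<notin> Units G"

text \<open>A factorization \<open>s = p\<^sub>1^k\<^sub>1 \<cdots> p\<^sub>m^k\<^sub>m\<close> with distinct \<open>p\<^sub>i \<in> P\<close> and \<open>k\<^sub>i > 0\<close>, taken up to
  the order of the factors, is recorded by its exponent function \<open>k\<close>, which is zero
  outside \<open>{p\<^sub>1, \<dots>, p\<^sub>m}\<close>.\<close>

definition factorization_over ::
    "('a, 'm) monoid_scheme \<Rightarrow> 'a set \<Rightarrow> ('a \<Rightarrow> nat) \<Rightarrow> 'a \<Rightarrow> bool" where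
  "factorization_over S P k s \<longleftrightarrow>
     finite {p. k p \<noteq> 0} \<and> {p. k p \<noteq> 0} \<subseteq> P \<and>
     s = (\<Otimes>\<^bsub>S\<^esub>p\<in>{p. k p \<noteq> 0}. p [^]\<^bsub>S\<^esub> k p)"

locale free_semigroup = reduced_semigroup +
  assumes free: "\<exists>P \<subseteq> carrier G - {\<one>}.
    \<forall>s \<in> carrier G - {\<one>}. \<exists>!k. factorization_over G P k s"

text \<open>Preservation of the unit is part of the structure; it is automatic when \<open>H\<close> is free,
  since \<open>\<one>\<close> is then the only idempotent of \<open>H\<close>.\<close>

definition semigroup_embedding ::
    "('a, 'm) monoid_scheme \<Rightarrow> ('b, 'n) monoid_scheme \<Rightarrow> ('a \<Rightarrow> 'b) \<Rightarrow> bool" where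
  "semigroup_embedding G H f \<longleftrightarrow> f \<in> mon G H \<and> f \<one>\<^bsub>G\<^esub> = \<one>\<^bsub>H\<^esub>"

text \<open>Condition (i) of a divisor theory; the same condition is imposed on the embedding of
  \<open>\<Gamma>\<close> into a free semigroup in the extension theorem.\<close>

definition reflects_quotients ::
    "('a, 'm) monoid_scheme \<Rightarrow> ('b, 'n) monoid_scheme \<Rightarrow> ('a \<Rightarrow> 'b) \<Rightarrow> bool" where
  "reflects_quotients G H f \<longleftrightarrow>
     (\<forall>a \<in> carrier G. \<forall>b \<in> carrier G. \<forall>s \<in> carrier H.
        f a = f b \<otimes>\<^bsub>H\<^esub> s \<longrightarrow> (\<exists>c \<in> carrier G. s = f c))"

definition divisor_theory ::
    "('g, 'm) monoid_scheme \<Rightarrow> ('d, 'n) monoid_scheme \<Rightarrow> ('g \<Rightarrow> 'd) \<Rightarrow> bool" where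
  "divisor_theory \<Gamma> D \<tau> \<longleftrightarrow>
     reduced_semigroup \<Gamma> \<and> free_semigroup D \<and> semigroup_embedding \<Gamma> D \<tau> \<and>
     reflects_quotients \<Gamma> D \<tau> \<and>
     (\<forall>d\<^sub>1 \<in> carrier D. \<forall>d\<^sub>2 \<in> carrier D.
        {a \<in> carrier \<Gamma>. \<exists>d \<in> carrier D. \<tau> a = d \<otimes>\<^bsub>D\<^esub> d\<^sub>1} =
        {b \<in> carrier \<Gamma>. \<exists>d \<in> carrier D. \<tau> b = d \<otimes>\<^bsub>D\<^esub> d\<^sub>2} \<longrightarrow> d\<^sub>1 = d\<^sub>2)"

text \<open>This is joint, not pairwise, coprimality; the empty set is coprime only if
  \<open>G\<close> is trivial.\<close>

definition coprime_in :: "('a, 'm) monoid_scheme \<Rightarrow> 'a set \<Rightarrow> bool" where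
  "coprime_in G X \<longleftrightarrow>
     \<not> (\<exists>d \<in> carrier G. d \<noteq> \<one>\<^bsub>G\<^esub> \<and> (\<forall>x \<in> X. d divides\<^bsub>G\<^esub> x))"

end

theory Submission
  imports Defs
begin

text \<open>
  Each \<open>d \<in> D\<close> is the greatest common divisor of the elements \<open>\<tau>(a)\<close> that it divides: this gcd has
  the same multiples in \<open>\<tau>(\<Gamma>)\<close> as \<open>d\<close>, so condition (ii) identifies the two. This suggests the
  definition \<open>\<beta>(d) = gcd {\<alpha>(a) | d divides \<tau>(a)}\<close>, with the gcd taken in \<open>S\<close>. What freeness
  contributes is that \<open>D\<close> and \<open>S\<close> are cancellative and that every nonempty subset, finite or not,
  has a gcd; in a reduced cancellative semigroup with such gcds, \<open>gcd(XY) = gcd(X) gcd(Y)\<close>.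

  The crucial step is that \<open>gcd \<alpha>(X)\<close> depends only on \<open>gcd \<tau>(X)\<close>. If \<open>gcd \<tau>(X) = \<tau>(a)\<close>, then by (i)
  every element of \<open>X\<close> is divisible by \<open>a\<close> in \<open>\<Gamma>\<close>, the quotients are coprime in \<open>D\<close>, hence coprime
  in \<open>S\<close> by \<open>(**)\<close>, and \<open>gcd \<alpha>(X) = \<alpha>(a)\<close>. If \<open>gcd \<tau>(X) = gcd \<tau>(Y) = d\<close> is arbitrary, choose \<open>e\<close> with
  \<open>d e = \<tau>(a)\<close> and let \<open>E\<close> consist of the \<open>b\<close> with \<open>\<tau>(b)\<close> divisible by \<open>e\<close>; both \<open>X E\<close> and \<open>Y E\<close> fall
  under the previous case, and \<open>gcd \<alpha>(E)\<close> can be cancelled. Multiplicativity of \<open>\<beta>\<close> and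
  \<open>\<beta> \<circ> \<tau> = \<alpha>\<close> are immediate consequences.

  Condition \<open>(*)\<close> makes \<open>\<beta>\<close> reflect divisibility, which gives injectivity. Finally, any other solution
  \<open>\<beta>'\<close> satisfies \<open>\<beta>'(d) | \<beta>(d)\<close> for all \<open>d\<close>, since \<open>\<beta>'(d)\<close> is a common divisor of the \<open>\<alpha>(a)\<close> in
  question. Multiplying by the same relation for \<open>e\<close>, where \<open>d e = \<tau>(a)\<close>, gives \<open>\<alpha>(a)\<close> on
  both sides, so neither divisibility can be strict.
\<close>

section \<open>Reduced semigroups with gcds of arbitrary nonempty sets\<close>

text \<open>The gcd is characterised by all its divisors at once, so that antisymmetry of divisibility
  is all that is needed to prove its uniqueness.\<close>

definition is_Gcd :: "('a, 'm) monoid_scheme \<Rightarrow> 'a set \<Rightarrow> 'a \<Rightarrow> bool" where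
  "is_Gcd G X g \<longleftrightarrow> g \<in> carrier G \<and>
     (\<forall>h \<in> carrier G. h divides\<^bsub>G\<^esub> g \<longleftrightarrow> (\<forall>x \<in> X. h divides\<^bsub>G\<^esub> x))"

definition Gcd_of :: "('a, 'm) monoid_scheme \<Rightarrow> 'a set \<Rightarrow> 'a" where
  "Gcd_of G X = (THE g. is_Gcd G X g)"

lemma (in reduced_semigroup) one_if_mult_eq_one:
  assumes "x \<in> carrier G" "y \<in> carrier G" "x \<otimes> y = \<one>"
  shows "x = \<one>"
proof (rule ccontr)
  assume "x \<noteq> \<one>"
  then have "x \<notin> Units G"
    using assms not_invertible by blast
  moreover have "x \<in> Units G"
    using assms m_comm[of x y] unfolding Units_def by auto
  ultimately show False by blast
qed

locale complete_gcd_semigroup = reduced_semigroup + comm_monoid_cancel +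
  assumes Gcd_exists: "\<lbrakk>X \<subseteq> carrier G; X \<noteq> {}\<rbrakk> \<Longrightarrow> \<exists>g. is_Gcd G X g"
begin

lemma divides_antisymmetric:
  assumes "x divides y" "y divides x" "x \<in> carrier G" "y \<in> carrier G"
  shows "x = y"
proof -
  obtain u where u: "u \<in> carrier G" "y = x \<otimes> u" using assms by (auto simp: factor_def)
  obtain v where v: "v \<in> carrier G" "x = y \<otimes> v" using assms by (auto simp: factor_def)
  have "x \<otimes> (u \<otimes> v) = x \<otimes> \<one>"
    using u v assms by (metis m_assoc r_one)
  then have "u \<otimes> v = \<one>"
    using u v assms by (meson l_cancel m_closed one_closed)
  then have "u = \<one>"
    using u v one_if_mult_eq_one by blast
  then show ?thesis using u assms by simp
qed

lemma Gcd_of_eqI: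
  assumes "is_Gcd G X g"
  shows "Gcd_of G X = g"
  unfolding Gcd_of_def
proof (rule the_equality)
  fix h assume "is_Gcd G X h"
  then show "h = g"
    using assms unfolding is_Gcd_def by (meson divides_antisymmetric divides_refl)
qed fact

lemma is_Gcd_Gcd_of:
  assumes "X \<subseteq> carrier G" "X \<noteq> {}"
  shows "is_Gcd G X (Gcd_of G X)"
  using Gcd_exists[OF assms] Gcd_of_eqI by auto

lemma Gcd_of_closed [simp]:
  assumes "X \<subseteq> carrier G" "X \<noteq> {}"
  shows "Gcd_of G X \<in> carrier G"
  using is_Gcd_Gcd_of[OF assms] by (simp add: is_Gcd_def)

lemma divides_Gcd_of_iff:
  assumes "X \<subseteq> carrier G" "X \<noteq> {}" "h \<in> carrier G"
  shows "h divides Gcd_of G X \<longleftrightarrow> (\<forall>x \<in> X. h divides x)"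
  using is_Gcd_Gcd_of assms by (simp add: is_Gcd_def)

lemma Gcd_of_divides:
  assumes "X \<subseteq> carrier G" "x \<in> X"
  shows "Gcd_of G X divides x"
  using assms divides_Gcd_of_iff[of X "Gcd_of G X"] by auto

lemma Gcd_of_singleton:
  assumes "x \<in> carrier G"
  shows "Gcd_of G {x} = x"
  using assms by (intro Gcd_of_eqI) (simp add: is_Gcd_def)

text \<open>This is the distributivity of multiplication over gcds. It follows from the existence of a gcd of
  \<open>cX\<close>: this gcd is a multiple \<open>c h\<close> of \<open>c\<close>, and \<open>h\<close> is a common divisor of \<open>X\<close> by cancellation.\<close>

lemma divides_mult_Gcd_of:
  assumes X: "X \<subseteq> carrier G" "X \<noteq> {}" and c: "c \<in> carrier G" and g: "g \<in> carrier G"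
    and dvd: "\<And>x. x \<in> X \<Longrightarrow> g divides c \<otimes> x"
  shows "g divides c \<otimes> Gcd_of G X"
proof -
  let ?cX = "(\<lambda>x. c \<otimes> x) ` X"
  have cX: "?cX \<subseteq> carrier G" "?cX \<noteq> {}" using X c by auto
  have "c divides Gcd_of G ?cX"
    using X c by (subst divides_Gcd_of_iff[OF cX c]) (auto simp: factor_def)
  then obtain h where h: "h \<in> carrier G" "Gcd_of G ?cX = c \<otimes> h"
    by (auto simp: factor_def)
  have "h divides x" if "x \<in> X" for x
  proof -
    have "c \<otimes> h divides c \<otimes> x"
      using Gcd_of_divides[OF cX(1), of "c \<otimes> x"] that h by auto
    then show ?thesis using divides_mult_l h c X that by blast
  qed
  then have "c \<otimes> h divides c \<otimes> Gcd_of G X"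
    using divides_Gcd_of_iff[OF X] h c by auto
  moreover have "g divides c \<otimes> h"
    using divides_Gcd_of_iff[OF cX g] dvd h by auto
  ultimately show ?thesis using g by (meson divides_trans)
qed

lemma Gcd_of_set_mult:
  assumes X: "X \<subseteq> carrier G" "X \<noteq> {}" and Y: "Y \<subseteq> carrier G" "Y \<noteq> {}"
  shows "Gcd_of G (X <#> Y) = Gcd_of G X \<otimes> Gcd_of G Y"
proof (rule Gcd_of_eqI, unfold is_Gcd_def, intro conjI ballI iffI)
  show "Gcd_of G X \<otimes> Gcd_of G Y \<in> carrier G" using X Y by simp
next
  fix h z
  assume h: "h \<in> carrier G" "h divides Gcd_of G X \<otimes> Gcd_of G Y" and "z \<in> X <#> Y"
  then obtain x y where xy: "x \<in> X" "y \<in> Y" "z = x \<otimes> y" by (auto simp: set_mult_def)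
  have c: "x \<in> carrier G" "y \<in> carrier G" using xy X Y by auto
  have gx: "Gcd_of G X \<otimes> Gcd_of G Y divides x \<otimes> Gcd_of G Y"
    using Gcd_of_divides[OF X(1) xy(1)] X Y c by simp
  have gy: "x \<otimes> Gcd_of G Y divides x \<otimes> y"
    using Gcd_of_divides[OF Y(1) xy(2)] X Y c by simp
  show "h divides z"
    unfolding xy(3) by (rule divides_trans[OF divides_trans[OF h(2) gx h(1)] gy h(1)])
next
  fix h
  assume h: "h \<in> carrier G" and dvd: "\<forall>z \<in> X <#> Y. h divides z"
  have "h divides Gcd_of G Y \<otimes> x" if x: "x \<in> X" for x
  proof -
    have "h divides x \<otimes> Gcd_of G Y"
      using x X Y h dvd by (intro divides_mult_Gcd_of) (auto simp: set_mult_def)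
    moreover have "x \<otimes> Gcd_of G Y = Gcd_of G Y \<otimes> x"
      using x X Y by (intro m_comm) auto
    ultimately show ?thesis by simp
  qed
  then have "h divides Gcd_of G Y \<otimes> Gcd_of G X"
    using X Y h by (intro divides_mult_Gcd_of) auto
  then show "h divides Gcd_of G X \<otimes> Gcd_of G Y"
    using X Y m_comm[of "Gcd_of G X" "Gcd_of G Y"] by simp
qed

lemma coprime_in_iff_Gcd_of:
  assumes X: "X \<subseteq> carrier G" "X \<noteq> {}"
  shows "coprime_in G X \<longleftrightarrow> Gcd_of G X = \<one>"
proof
  assume "coprime_in G X"
  then show "Gcd_of G X = \<one>"
    using Gcd_of_divides[OF X(1)] Gcd_of_closed[OF X] unfolding coprime_in_def by blast
next
  assume gcd: "Gcd_of G X = \<one>"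
  have "d = \<one>" if "d \<in> carrier G" "\<forall>x\<in>X. d divides x" for d
  proof -
    have "d divides \<one>" using divides_Gcd_of_iff[OF X] that gcd by metis
    then show ?thesis using that one_if_mult_eq_one by (metis factor_def)
  qed
  then show "coprime_in G X" unfolding coprime_in_def by blast
qed

end

section \<open>Free semigroups have gcds\<close>

definition monomial :: "('a, 'm) monoid_scheme \<Rightarrow> ('a \<Rightarrow> nat) \<Rightarrow> 'a" where
  "monomial G k = (\<Otimes>\<^bsub>G\<^esub>p\<in>{p. k p \<noteq> 0}. p [^]\<^bsub>G\<^esub> k p)"

definition exponents :: "'a set \<Rightarrow> ('a \<Rightarrow> nat) set" where
  "exponents P = {k. finite {p. k p \<noteq> 0} \<and> {p. k p \<noteq> 0} \<subseteq> P}"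

lemma exponents_add:
  assumes "k \<in> exponents P" "l \<in> exponents P"
  shows "(\<lambda>p. k p + l p) \<in> exponents P"
proof -
  have "{p. k p + l p \<noteq> 0} = {p. k p \<noteq> 0} \<union> {p. l p \<noteq> 0}" by auto
  then show ?thesis using assms unfolding exponents_def by simp
qed

lemma exponents_le:
  assumes "k \<in> exponents P" "\<And>p. l p \<le> k p"
  shows "l \<in> exponents P"
proof -
  have "k p \<noteq> 0" if "l p \<noteq> 0" for p using assms(2)[of p] that by simp
  then have "{p. l p \<noteq> 0} \<subseteq> {p. k p \<noteq> 0}" by auto
  then show ?thesis using assms(1) finite_subset unfolding exponents_def by auto
qed

lemma (in comm_monoid) monomial_closed:
  assumes "P \<subseteq> carrier G" "k \<in> exponents P"
  shows "monomial G k \<in> carrier G"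
  unfolding monomial_def using assms by (intro finprod_closed) (auto simp: exponents_def)

lemma (in comm_monoid) monomial_add:
  assumes P: "P \<subseteq> carrier G" and k: "k \<in> exponents P" and l: "l \<in> exponents P"
  shows "monomial G (\<lambda>p. k p + l p) = monomial G k \<otimes> monomial G l"
proof -
  \<comment> \<open>All three products are taken over the common finite support \<open>F\<close>.\<close>
  let ?F = "{p. k p \<noteq> 0} \<union> {p. l p \<noteq> 0}"
  have F: "finite ?F" "?F \<subseteq> carrier G" using assms by (auto simp: exponents_def)
  have ext: "monomial G m = (\<Otimes>p\<in>?F. p [^] m p)" if "{p. m p \<noteq> 0} \<subseteq> ?F" for m :: "'a \<Rightarrow> nat"
    unfolding monomial_def using F that
    by (intro finprod_mono_neutral_cong_left) auto
  have "monomial G (\<lambda>p. k p + l p) = (\<Otimes>p\<in>?F. p [^] (k p + l p))"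
    by (rule ext) auto
  also have "\<dots> = (\<Otimes>p\<in>?F. p [^] k p \<otimes> p [^] l p)"
    using F by (intro finprod_cong') (auto simp: nat_pow_mult)
  also have "\<dots> = (\<Otimes>p\<in>?F. p [^] k p) \<otimes> (\<Otimes>p\<in>?F. p [^] l p)"
    using F by (intro finprod_multf) auto
  also have "\<dots> = monomial G k \<otimes> monomial G l"
    using ext[of k] ext[of l] by auto
  finally show ?thesis .
qed

text \<open>The definition of freeness says nothing about factorizations of the unit. A factorization of
  \<open>\<one>\<close> with a nonzero exponent would make some \<open>p \<in> P\<close> invertible, which \<open>p \<noteq> \<one>\<close> excludes.\<close>

lemma (in free_semigroup) monomial_bij:
  obtains P where "P \<subseteq> carrier G" "bij_betw (monomial G) (exponents P) (carrier G)"
proof -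
  obtain P where P: "P \<subseteq> carrier G - {\<one>}"
    and free: "\<forall>s \<in> carrier G - {\<one>}. \<exists>!k. factorization_over G P k s"
    using free by blast
  have fact: "factorization_over G P k s \<longleftrightarrow> k \<in> exponents P \<and> s = monomial G k" for k s
    by (auto simp: factorization_over_def exponents_def monomial_def)
  have PG: "P \<subseteq> carrier G" using P by blast
  have trivial: "k p = 0" if k: "k \<in> exponents P" and one: "monomial G k = \<one>" for k p
  proof (rule ccontr)
    assume p: "k p \<noteq> 0"
    then have pP: "p \<in> P" using k by (auto simp: exponents_def)
    let ?d = "\<lambda>q. if q = p then 1 else (0::nat)" and ?k' = "\<lambda>q. if q = p then k p - 1 else k q"
    have d: "?d \<in> exponents P" using pP by (auto simp: exponents_def)
    have k': "?k' \<in> exponents P" by (rule exponents_le[OF k]) auto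
    have "{q. ?d q \<noteq> 0} = {p}" by auto
    then have "monomial G ?d = (\<Otimes>q\<in>{p}. q [^] ?d q)" unfolding monomial_def by simp
    also have "\<dots> = p" using pP PG by (subst finprod_insert) auto
    finally have md: "monomial G ?d = p" .
    have "k = (\<lambda>q. ?d q + ?k' q)" using p by auto
    then have "\<one> = p \<otimes> monomial G ?k'"
      using monomial_add[OF PG d k'] one md by simp
    then have "p = \<one>"
      using one_if_mult_eq_one[of p] monomial_closed[OF PG k'] pP PG by auto
    then show False using pP P by blast
  qed
  have "inj_on (monomial G) (exponents P)"
  proof (rule inj_onI)
    fix k l assume k: "k \<in> exponents P" and l: "l \<in> exponents P"
      and eq: "monomial G k = monomial G l"
    show "k = l"
    proof (cases "monomial G k = \<one>")
      case True
      then show ?thesis using trivial[OF k] trivial[OF l] eq by auto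
    next
      case False
      then have "\<exists>!k'. factorization_over G P k' (monomial G k)"
        using free monomial_closed[OF PG k] by blast
      then show ?thesis using k l eq unfolding fact by blast
    qed
  qed
  moreover have "monomial G ` exponents P = carrier G"
  proof (intro equalityI subsetI)
    fix s assume s: "s \<in> carrier G"
    show "s \<in> monomial G ` exponents P"
    proof (cases "s = \<one>")
      case True
      have "(\<lambda>_. 0) \<in> exponents P" "monomial G (\<lambda>_. 0) = \<one>"
        by (auto simp: exponents_def monomial_def)
      then show ?thesis using True by (metis imageI)
    next
      case False
      then show ?thesis using s free fact by blast
    qed
  qed (use monomial_closed[OF PG] in auto)
  ultimately show thesis using that PG by (auto simp: bij_betw_def)
qed

text \<open>In terms of exponents, divisibility is the pointwise order, and the gcd is the pointwise
  minimum; the minimum again has finite support because it lies below any one member of the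
  set.\<close>

sublocale free_semigroup \<subseteq> complete_gcd_semigroup
proof -
  obtain P where PG: "P \<subseteq> carrier G" and bij: "bij_betw (monomial G) (exponents P) (carrier G)"
    by (rule monomial_bij)
  have inj: "k = l" if "k \<in> exponents P" "l \<in> exponents P" "monomial G k = monomial G l" for k l
    using bij that by (auto simp: bij_betw_def inj_on_def)
  have surj: "\<exists>k \<in> exponents P. s = monomial G k" if "s \<in> carrier G" for s
    using bij that by (auto simp: bij_betw_def)
  have dvd: "monomial G k divides monomial G l \<longleftrightarrow> (\<forall>p. k p \<le> l p)"
    if k: "k \<in> exponents P" and l: "l \<in> exponents P" for k l
  proof
    assume "monomial G k divides monomial G l"
    then obtain m where m: "m \<in> exponents P" "monomial G l = monomial G k \<otimes> monomial G m"
      using surj by (auto simp: factor_def)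
    then have "l = (\<lambda>p. k p + m p)"
      using monomial_add[OF PG k] exponents_add k l inj by metis
    then show "\<forall>p. k p \<le> l p" by auto
  next
    assume le: "\<forall>p. k p \<le> l p"
    then have m: "(\<lambda>p. l p - k p) \<in> exponents P" by (intro exponents_le[OF l]) auto
    have "monomial G k \<otimes> monomial G (\<lambda>p. l p - k p) = monomial G (\<lambda>p. k p + (l p - k p))"
      using monomial_add[OF PG k m] by simp
    also have "(\<lambda>p. k p + (l p - k p)) = l" using le by auto
    finally show "monomial G k divides monomial G l"
      using dividesI[OF monomial_closed[OF PG m]] by metis
  qed
  have cancel: "a = b" if "c \<otimes> a = c \<otimes> b" "a \<in> carrier G" "b \<in> carrier G" "c \<in> carrier G" for a b c
  proof -
    obtain i where i: "i \<in> exponents P" "a = monomial G i" using surj \<open>a \<in> carrier G\<close> by blast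
    obtain j where j: "j \<in> exponents P" "b = monomial G j" using surj \<open>b \<in> carrier G\<close> by blast
    obtain k where k: "k \<in> exponents P" "c = monomial G k" using surj \<open>c \<in> carrier G\<close> by blast
    have "monomial G (\<lambda>p. k p + i p) = monomial G (\<lambda>p. k p + j p)"
      using that(1) i j k by (simp add: monomial_add[OF PG])
    then have "(\<lambda>p. k p + i p) = (\<lambda>p. k p + j p)"
      by (rule inj[OF exponents_add[OF k(1) i(1)] exponents_add[OF k(1) j(1)]])
    then have "i = j" by (simp add: fun_eq_iff)
    then show ?thesis using i j by simp
  qed
  have gcd: "\<exists>g. is_Gcd G X g" if X: "X \<subseteq> carrier G" "X \<noteq> {}" for X
  proof -
    define K where "K = {k \<in> exponents P. monomial G k \<in> X}"
    have XK: "X = monomial G ` K"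
    proof (intro equalityI subsetI)
      fix x assume x: "x \<in> X"
      then obtain k where "k \<in> exponents P" "x = monomial G k" using X(1) surj by blast
      then show "x \<in> monomial G ` K" using x by (simp add: K_def)
    qed (auto simp: K_def)
    have KP: "K \<subseteq> exponents P" by (auto simp: K_def)
    have "K \<noteq> {}" using X(2) XK by blast
    then obtain k where k: "k \<in> K" by blast
    define m where "m p = Inf ((\<lambda>k. k p) ` K)" for p
    have m_le: "n \<le> m p \<longleftrightarrow> (\<forall>k \<in> K. n \<le> k p)" for n p
      unfolding m_def using k le_cInf_iff[of "(\<lambda>k. k p) ` K" n] by auto
    have m: "m \<in> exponents P"
    proof (rule exponents_le)
      show "k \<in> exponents P" using k KP by blast
      show "m p \<le> k p" for p using m_le[of "m p" p] k by blast
    qed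
    have "h divides monomial G m \<longleftrightarrow> (\<forall>x \<in> X. h divides x)" if h: "h \<in> carrier G" for h
    proof -
      obtain l where l: "l \<in> exponents P" "h = monomial G l" using h surj by blast
      have "(\<forall>x \<in> X. h divides x) \<longleftrightarrow> (\<forall>k \<in> K. monomial G l divides monomial G k)"
        using XK l by simp
      also have "\<dots> \<longleftrightarrow> (\<forall>k \<in> K. \<forall>p. l p \<le> k p)"
        using dvd[OF l(1)] KP by (intro ball_cong) auto
      also have "\<dots> \<longleftrightarrow> (\<forall>p. l p \<le> m p)" by (auto simp: m_le)
      finally show ?thesis using dvd l m by simp
    qed
    then show ?thesis
      using monomial_closed[OF PG m] unfolding is_Gcd_def by blast
  qed
  show "complete_gcd_semigroup G"
  proof unfold_locales
    fix a b c assume "a \<otimes> c = b \<otimes> c" "a \<in> carrier G" "b \<in> carrier G" "c \<in> carrier G"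
    then show "a = b" using cancel[of c a b] by (simp add: m_comm)
  qed (fact cancel gcd)+
qed

section \<open>Extending an embedding from principal divisors to all divisors\<close>

lemma hom_image_set_mult:
  assumes "f \<in> hom G H" "X \<subseteq> carrier G" "Y \<subseteq> carrier G"
  shows "f ` (X <#>\<^bsub>G\<^esub> Y) = f ` X <#>\<^bsub>H\<^esub> f ` Y"
proof -
  have mult: "f (x \<otimes>\<^bsub>G\<^esub> y) = f x \<otimes>\<^bsub>H\<^esub> f y" if "x \<in> X" "y \<in> Y" for x y
    using assms that by (intro hom_mult[of f G H]) auto
  have "f ` (X <#>\<^bsub>G\<^esub> Y) = (\<Union>x\<in>X. \<Union>y\<in>Y. {f (x \<otimes>\<^bsub>G\<^esub> y)})"
    by (auto simp: set_mult_def)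
  also have "\<dots> = f ` X <#>\<^bsub>H\<^esub> f ` Y"
    using mult by (simp add: set_mult_def)
  finally show ?thesis .
qed

text \<open>The assumptions are those of the extension theorem, with freeness of \<open>D\<close> and \<open>S\<close> replaced by
  its consequence of the existence of gcds, and with condition (ii) stated in terms of
  divisibility.\<close>

locale divisor_extension =
  \<Gamma>: comm_monoid \<Gamma> + D: complete_gcd_semigroup D + S: complete_gcd_semigroup S
  for \<Gamma> :: "('g, 'm) monoid_scheme" and D :: "('d, 'n) monoid_scheme"
    and S :: "('s, 'k) monoid_scheme" +
  fixes \<tau> :: "'g \<Rightarrow> 'd" and \<alpha> :: "'g \<Rightarrow> 's"
  assumes emb_\<tau>: "semigroup_embedding \<Gamma> D \<tau>" and refl_\<tau>: "reflects_quotients \<Gamma> D \<tau>"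
    and emb_\<alpha>: "semigroup_embedding \<Gamma> S \<alpha>" and refl_\<alpha>: "reflects_quotients \<Gamma> S \<alpha>"
    and divisor_eqI: "\<lbrakk>d\<^sub>1 \<in> carrier D; d\<^sub>2 \<in> carrier D;
          \<And>a. a \<in> carrier \<Gamma> \<Longrightarrow> d\<^sub>1 divides\<^bsub>D\<^esub> \<tau> a \<longleftrightarrow> d\<^sub>2 divides\<^bsub>D\<^esub> \<tau> a\<rbrakk> \<Longrightarrow> d\<^sub>1 = d\<^sub>2"
    and coprime_transfer:
      "\<lbrakk>A \<subseteq> carrier \<Gamma>; coprime_in D (\<tau> ` A)\<rbrakk> \<Longrightarrow> coprime_in S (\<alpha> ` A)"
begin

lemma \<tau>_closed [simp]: "a \<in> carrier \<Gamma> \<Longrightarrow> \<tau> a \<in> carrier D"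
  and \<tau>_mult: "\<lbrakk>a \<in> carrier \<Gamma>; b \<in> carrier \<Gamma>\<rbrakk> \<Longrightarrow> \<tau> (a \<otimes>\<^bsub>\<Gamma>\<^esub> b) = \<tau> a \<otimes>\<^bsub>D\<^esub> \<tau> b"
  and \<tau>_inj: "\<lbrakk>\<tau> a = \<tau> b; a \<in> carrier \<Gamma>; b \<in> carrier \<Gamma>\<rbrakk> \<Longrightarrow> a = b"
  and \<tau>_one: "\<tau> \<one>\<^bsub>\<Gamma>\<^esub> = \<one>\<^bsub>D\<^esub>"
  using emb_\<tau> unfolding semigroup_embedding_def mon_def hom_def inj_on_def by auto

lemma \<alpha>_closed [simp]: "a \<in> carrier \<Gamma> \<Longrightarrow> \<alpha> a \<in> carrier S"
  and \<alpha>_mult: "\<lbrakk>a \<in> carrier \<Gamma>; b \<in> carrier \<Gamma>\<rbrakk> \<Longrightarrow> \<alpha> (a \<otimes>\<^bsub>\<Gamma>\<^esub> b) = \<alpha> a \<otimes>\<^bsub>S\<^esub> \<alpha> b"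
  and \<alpha>_inj: "\<lbrakk>\<alpha> a = \<alpha> b; a \<in> carrier \<Gamma>; b \<in> carrier \<Gamma>\<rbrakk> \<Longrightarrow> a = b"
  and \<alpha>_one: "\<alpha> \<one>\<^bsub>\<Gamma>\<^esub> = \<one>\<^bsub>S\<^esub>"
  using emb_\<alpha> unfolding semigroup_embedding_def mon_def hom_def inj_on_def by auto

lemma divides_if_\<tau>_divides:
  assumes "a \<in> carrier \<Gamma>" "b \<in> carrier \<Gamma>" "\<tau> a divides\<^bsub>D\<^esub> \<tau> b"
  shows "a divides\<^bsub>\<Gamma>\<^esub> b"
proof -
  obtain c where "c \<in> carrier \<Gamma>" "\<tau> b = \<tau> a \<otimes>\<^bsub>D\<^esub> \<tau> c"
    using assms refl_\<tau> unfolding reflects_quotients_def factor_def by metis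
  then show ?thesis using assms \<tau>_mult \<tau>_inj unfolding factor_def by (metis \<Gamma>.m_closed)
qed

lemma divides_if_\<alpha>_divides:
  assumes "a \<in> carrier \<Gamma>" "b \<in> carrier \<Gamma>" "\<alpha> a divides\<^bsub>S\<^esub> \<alpha> b"
  shows "a divides\<^bsub>\<Gamma>\<^esub> b"
proof -
  obtain c where "c \<in> carrier \<Gamma>" "\<alpha> b = \<alpha> a \<otimes>\<^bsub>S\<^esub> \<alpha> c"
    using assms refl_\<alpha> unfolding reflects_quotients_def factor_def by metis
  then show ?thesis using assms \<alpha>_mult \<alpha>_inj unfolding factor_def by (metis \<Gamma>.m_closed)
qed

lemma \<tau>_divides:
  assumes "a divides\<^bsub>\<Gamma>\<^esub> b" "a \<in> carrier \<Gamma>"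
  shows "\<tau> a divides\<^bsub>D\<^esub> \<tau> b"
  using assms \<tau>_mult unfolding factor_def by auto

definition multiples :: "'d \<Rightarrow> 'g set" where
  "multiples d = {a \<in> carrier \<Gamma>. d divides\<^bsub>D\<^esub> \<tau> a}"

lemma multiples_subset: "multiples d \<subseteq> carrier \<Gamma>"
  by (auto simp: multiples_def)

text \<open>If \<open>d\<close> had no multiples in \<open>\<tau>(\<Gamma>)\<close>, neither would \<open>d\<^sup>2\<close>, so that \<open>d = d\<^sup>2\<close> and hence \<open>d = \<one>\<close>; but
  everything is a multiple of \<open>\<one>\<close>.\<close>

lemma multiples_nonempty:
  assumes d: "d \<in> carrier D"
  shows "multiples d \<noteq> {}"
proof
  assume empty: "multiples d = {}"
  then have no: "\<not> d divides\<^bsub>D\<^esub> \<tau> a" if "a \<in> carrier \<Gamma>" for a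
    using that by (auto simp: multiples_def)
  moreover have "\<not> d \<otimes>\<^bsub>D\<^esub> d divides\<^bsub>D\<^esub> \<tau> a" if "a \<in> carrier \<Gamma>" for a
    using no[OF that] d by (meson D.divides_prod_r D.divides_refl D.divides_trans)
  ultimately have "d \<otimes>\<^bsub>D\<^esub> d = d" using d by (intro divisor_eqI) auto
  then have "d \<otimes>\<^bsub>D\<^esub> d = d \<otimes>\<^bsub>D\<^esub> \<one>\<^bsub>D\<^esub>" using d by simp
  then have "d = \<one>\<^bsub>D\<^esub>" using d D.l_cancel by blast
  then have "d divides\<^bsub>D\<^esub> \<tau> \<one>\<^bsub>\<Gamma>\<^esub>" using \<tau>_one by simp
  then show False using no by blast
qed

lemma complementary_divisor:
  assumes d: "d \<in> carrier D"
  obtains a e where "a \<in> carrier \<Gamma>" "e \<in> carrier D" "\<tau> a = d \<otimes>\<^bsub>D\<^esub> e"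
  using multiples_nonempty[OF d] by (auto simp: multiples_def factor_def)

abbreviation Gcd_\<tau> :: "'g set \<Rightarrow> 'd" where
  "Gcd_\<tau> X \<equiv> Gcd_of D (\<tau> ` X)"

abbreviation Gcd_\<alpha> :: "'g set \<Rightarrow> 's" where
  "Gcd_\<alpha> X \<equiv> Gcd_of S (\<alpha> ` X)"

lemma \<tau>_image_subset: "X \<subseteq> carrier \<Gamma> \<Longrightarrow> \<tau> ` X \<subseteq> carrier D"
  and \<alpha>_image_subset: "X \<subseteq> carrier \<Gamma> \<Longrightarrow> \<alpha> ` X \<subseteq> carrier S"
  by auto

lemma set_mult_nonempty:
  assumes "X \<noteq> {}" "Y \<noteq> {}"
  shows "X <#>\<^bsub>\<Gamma>\<^esub> Y \<noteq> {}"
  using assms by (auto simp: set_mult_def)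

lemma Gcd_\<tau>_set_mult:
  assumes "X \<subseteq> carrier \<Gamma>" "X \<noteq> {}" "Y \<subseteq> carrier \<Gamma>" "Y \<noteq> {}"
  shows "Gcd_\<tau> (X <#>\<^bsub>\<Gamma>\<^esub> Y) = Gcd_\<tau> X \<otimes>\<^bsub>D\<^esub> Gcd_\<tau> Y"
proof -
  have "\<tau> \<in> hom \<Gamma> D"
    using emb_\<tau> by (simp add: semigroup_embedding_def mon_def)
  then have "\<tau> ` (X <#>\<^bsub>\<Gamma>\<^esub> Y) = \<tau> ` X <#>\<^bsub>D\<^esub> \<tau> ` Y"
    using assms by (intro hom_image_set_mult)
  then show ?thesis using assms by (simp add: D.Gcd_of_set_mult \<tau>_image_subset)
qed

lemma Gcd_\<alpha>_set_mult:
  assumes "X \<subseteq> carrier \<Gamma>" "X \<noteq> {}" "Y \<subseteq> carrier \<Gamma>" "Y \<noteq> {}"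
  shows "Gcd_\<alpha> (X <#>\<^bsub>\<Gamma>\<^esub> Y) = Gcd_\<alpha> X \<otimes>\<^bsub>S\<^esub> Gcd_\<alpha> Y"
proof -
  have "\<alpha> \<in> hom \<Gamma> S"
    using emb_\<alpha> by (metis (lifting) semigroup_embedding_def mon_def mem_Collect_eq)
  then have "\<alpha> ` (X <#>\<^bsub>\<Gamma>\<^esub> Y) = \<alpha> ` X <#>\<^bsub>S\<^esub> \<alpha> ` Y"
    using assms by (intro hom_image_set_mult)
  then show ?thesis using assms by (simp add: S.Gcd_of_set_mult \<alpha>_image_subset)
qed

text \<open>The gcd of the multiples of \<open>d\<close> has the same multiples in \<open>\<tau>(\<Gamma>)\<close> as \<open>d\<close>, and a divisor is
  determined by these.\<close>

lemma Gcd_\<tau>_multiples: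
  assumes d: "d \<in> carrier D"
  shows "Gcd_\<tau> (multiples d) = d"
proof -
  let ?M = "\<tau> ` multiples d"
  have M: "?M \<subseteq> carrier D" "?M \<noteq> {}"
    using multiples_nonempty[OF d] by (auto simp: multiples_def)
  have g: "Gcd_of D ?M \<in> carrier D" using M by simp
  have d_g: "d divides\<^bsub>D\<^esub> Gcd_of D ?M"
    using D.divides_Gcd_of_iff[OF M d] by (auto simp: multiples_def)
  show ?thesis
  proof (rule divisor_eqI[OF g d])
    fix a assume a: "a \<in> carrier \<Gamma>"
    show "Gcd_of D ?M divides\<^bsub>D\<^esub> \<tau> a \<longleftrightarrow> d divides\<^bsub>D\<^esub> \<tau> a"
    proof
      assume "Gcd_of D ?M divides\<^bsub>D\<^esub> \<tau> a"
      then show "d divides\<^bsub>D\<^esub> \<tau> a" using D.divides_trans[OF d_g _ d] by blast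
    next
      assume "d divides\<^bsub>D\<^esub> \<tau> a"
      then show "Gcd_of D ?M divides\<^bsub>D\<^esub> \<tau> a"
        using a by (intro D.Gcd_of_divides[OF M(1)]) (simp add: multiples_def)
    qed
  qed
qed

text \<open>Condition (i) allows dividing \<open>X\<close> by \<open>a\<close> inside \<open>\<Gamma>\<close>, and \<open>(**)\<close> applies to the quotients.\<close>

lemma Gcd_\<alpha>_eq_if_Gcd_\<tau>_principal:
  assumes X: "X \<subseteq> carrier \<Gamma>" "X \<noteq> {}" and a: "a \<in> carrier \<Gamma>" and gcd: "Gcd_\<tau> X = \<tau> a"
  shows "Gcd_\<alpha> X = \<alpha> a"
proof -
  define Z where "Z = {z \<in> carrier \<Gamma>. a \<otimes>\<^bsub>\<Gamma>\<^esub> z \<in> X}"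
  have "\<exists>z \<in> carrier \<Gamma>. x = a \<otimes>\<^bsub>\<Gamma>\<^esub> z" if x: "x \<in> X" for x
  proof -
    have "\<tau> a divides\<^bsub>D\<^esub> \<tau> x"
      using D.Gcd_of_divides[OF \<tau>_image_subset[OF X(1)], of "\<tau> x"] x gcd by auto
    then show ?thesis using divides_if_\<tau>_divides[of a x] a X x by (auto simp: factor_def)
  qed
  then have XZ: "X = {a} <#>\<^bsub>\<Gamma>\<^esub> Z" unfolding Z_def set_mult_def by auto
  have Z: "Z \<subseteq> carrier \<Gamma>" "Z \<noteq> {}"
  proof -
    show "Z \<subseteq> carrier \<Gamma>" by (auto simp: Z_def)
    show "Z \<noteq> {}" using X(2) XZ by (auto simp: set_mult_def)
  qed
  have Z\<tau>: "\<tau> ` Z \<subseteq> carrier D" "\<tau> ` Z \<noteq> {}" and Z\<alpha>: "\<alpha> ` Z \<subseteq> carrier S" "\<alpha> ` Z \<noteq> {}"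
    using Z by auto
  have "\<tau> a \<otimes>\<^bsub>D\<^esub> Gcd_\<tau> Z = \<tau> a \<otimes>\<^bsub>D\<^esub> \<one>\<^bsub>D\<^esub>"
    using Gcd_\<tau>_set_mult[of "{a}" Z] gcd Z a XZ by (simp add: D.Gcd_of_singleton)
  then have "Gcd_\<tau> Z = \<one>\<^bsub>D\<^esub>"
    using D.l_cancel a D.Gcd_of_closed[OF Z\<tau>] by (meson D.one_closed \<tau>_closed)
  then have "coprime_in S (\<alpha> ` Z)"
    using coprime_transfer[OF Z(1)] D.coprime_in_iff_Gcd_of[OF Z\<tau>] by simp
  then have "Gcd_\<alpha> Z = \<one>\<^bsub>S\<^esub>"
    using S.coprime_in_iff_Gcd_of[OF Z\<alpha>] by simp
  then show ?thesis
    using Gcd_\<alpha>_set_mult[of "{a}" Z] Z a XZ by (simp add: S.Gcd_of_singleton)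
qed

text \<open>Multiplication by the multiples of a complementary divisor reduces this to the principal
  case.\<close>

lemma Gcd_\<alpha>_eq_if_Gcd_\<tau>_eq:
  assumes X: "X \<subseteq> carrier \<Gamma>" "X \<noteq> {}" and Y: "Y \<subseteq> carrier \<Gamma>" "Y \<noteq> {}"
    and eq: "Gcd_\<tau> X = Gcd_\<tau> Y"
  shows "Gcd_\<alpha> X = Gcd_\<alpha> Y"
proof -
  have "Gcd_\<tau> X \<in> carrier D" using X by (simp add: \<tau>_image_subset)
  then obtain a e where a: "a \<in> carrier \<Gamma>" and e: "e \<in> carrier D" and ae: "\<tau> a = Gcd_\<tau> X \<otimes>\<^bsub>D\<^esub> e"
    by (rule complementary_divisor)
  let ?E = "multiples e"
  note E = multiples_subset[of e] multiples_nonempty[OF e]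
  have "Gcd_\<alpha> W \<otimes>\<^bsub>S\<^esub> Gcd_\<alpha> ?E = \<alpha> a"
    if W: "W \<subseteq> carrier \<Gamma>" "W \<noteq> {}" "Gcd_\<tau> W = Gcd_\<tau> X" for W
  proof -
    have "Gcd_\<tau> (W <#>\<^bsub>\<Gamma>\<^esub> ?E) = \<tau> a"
      using Gcd_\<tau>_set_mult[OF W(1,2) E] Gcd_\<tau>_multiples[OF e] W ae by simp
    then have "Gcd_\<alpha> (W <#>\<^bsub>\<Gamma>\<^esub> ?E) = \<alpha> a"
      using \<Gamma>.set_mult_closed[OF W(1) E(1)] set_mult_nonempty[OF W(2) E(2)] a
      by (intro Gcd_\<alpha>_eq_if_Gcd_\<tau>_principal)
    then show ?thesis using Gcd_\<alpha>_set_mult[OF W(1,2) E] by simp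
  qed
  from this[OF X refl] this[OF Y eq[symmetric]]
  have "Gcd_\<alpha> X \<otimes>\<^bsub>S\<^esub> Gcd_\<alpha> ?E = Gcd_\<alpha> Y \<otimes>\<^bsub>S\<^esub> Gcd_\<alpha> ?E" by simp
  moreover have "Gcd_\<alpha> X \<in> carrier S" "Gcd_\<alpha> Y \<in> carrier S" "Gcd_\<alpha> ?E \<in> carrier S"
    using X Y E by (simp_all add: \<alpha>_image_subset)
  ultimately show ?thesis using S.r_cancel by blast
qed

definition extension :: "'d \<Rightarrow> 's" where
  "extension d = Gcd_\<alpha> (multiples d)"

lemma extension_closed [simp]:
  assumes "d \<in> carrier D"
  shows "extension d \<in> carrier S"
  unfolding extension_def using multiples_nonempty[OF assms]
  by (simp add: \<alpha>_image_subset multiples_subset)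

text \<open>The two sides are gcds over different subsets of \<open>\<Gamma>\<close>: the product of the multiples of \<open>d\<close>
  and those of \<open>e\<close> may be smaller than the set of multiples of \<open>d e\<close>. Both have gcd \<open>d e\<close> in \<open>D\<close>,
  which suffices.\<close>

lemma extension_mult:
  assumes d: "d \<in> carrier D" and e: "e \<in> carrier D"
  shows "extension (d \<otimes>\<^bsub>D\<^esub> e) = extension d \<otimes>\<^bsub>S\<^esub> extension e"
proof -
  have de: "d \<otimes>\<^bsub>D\<^esub> e \<in> carrier D" using d e by simp
  note M = multiples_subset multiples_nonempty
  have "Gcd_\<tau> (multiples (d \<otimes>\<^bsub>D\<^esub> e)) = Gcd_\<tau> (multiples d <#>\<^bsub>\<Gamma>\<^esub> multiples e)"
    using Gcd_\<tau>_multiples d e de by (simp add: Gcd_\<tau>_set_mult M)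
  then have "extension (d \<otimes>\<^bsub>D\<^esub> e) = Gcd_\<alpha> (multiples d <#>\<^bsub>\<Gamma>\<^esub> multiples e)"
    unfolding extension_def using d e de
    by (intro Gcd_\<alpha>_eq_if_Gcd_\<tau>_eq M \<Gamma>.set_mult_closed set_mult_nonempty)
  then show ?thesis unfolding extension_def using d e by (simp add: Gcd_\<alpha>_set_mult M)
qed

lemma extension_\<tau>:
  assumes a: "a \<in> carrier \<Gamma>"
  shows "extension (\<tau> a) = \<alpha> a"
  unfolding extension_def
  by (rule Gcd_\<alpha>_eq_if_Gcd_\<tau>_principal
      [OF multiples_subset multiples_nonempty[OF \<tau>_closed[OF a]] a Gcd_\<tau>_multiples[OF \<tau>_closed[OF a]]])

text \<open>After multiplication by a complement \<open>e\<close> of \<open>d\<close>, the hypothesis says that \<open>\<alpha>(a)\<close>, where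
  \<open>\<tau>(a) = d e\<close>, divides \<open>\<alpha>(x)\<close> for all multiples \<open>x\<close> of \<open>d' e\<close>. By \<open>(*)\<close> this divisibility already
  holds in \<open>\<Gamma>\<close>, hence \<open>d e\<close> divides the gcd \<open>d' e\<close> of the \<open>\<tau>(x)\<close>.\<close>

lemma divides_if_extension_divides:
  assumes d: "d \<in> carrier D" and d': "d' \<in> carrier D"
    and dvd: "extension d divides\<^bsub>S\<^esub> extension d'"
  shows "d divides\<^bsub>D\<^esub> d'"
proof -
  obtain a e where a: "a \<in> carrier \<Gamma>" and e: "e \<in> carrier D" and ae: "\<tau> a = d \<otimes>\<^bsub>D\<^esub> e"
    using complementary_divisor[OF d] .
  have d'e: "d' \<otimes>\<^bsub>D\<^esub> e \<in> carrier D" using d' e by simp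
  let ?M = "multiples (d' \<otimes>\<^bsub>D\<^esub> e)"
  note M = multiples_subset[of "d' \<otimes>\<^bsub>D\<^esub> e"] multiples_nonempty[OF d'e]
  have M\<alpha>: "\<alpha> ` ?M \<subseteq> carrier S" "\<alpha> ` ?M \<noteq> {}" and M\<tau>: "\<tau> ` ?M \<subseteq> carrier D" "\<tau> ` ?M \<noteq> {}"
    using M by auto
  have "extension d \<otimes>\<^bsub>S\<^esub> extension e divides\<^bsub>S\<^esub> extension d' \<otimes>\<^bsub>S\<^esub> extension e"
    using dvd d d' e by simp
  then have "\<alpha> a divides\<^bsub>S\<^esub> Gcd_\<alpha> ?M"
    using extension_mult d d' e extension_\<tau>[OF a] ae unfolding extension_def by simp
  then have "\<forall>x \<in> ?M. \<alpha> a divides\<^bsub>S\<^esub> \<alpha> x"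
    using S.divides_Gcd_of_iff[OF M\<alpha>] a by simp
  then have "\<forall>x \<in> ?M. \<tau> a divides\<^bsub>D\<^esub> \<tau> x"
    using divides_if_\<alpha>_divides \<tau>_divides a M by blast
  then have "\<tau> a divides\<^bsub>D\<^esub> Gcd_\<tau> ?M"
    using D.divides_Gcd_of_iff[OF M\<tau>] a by simp
  then have "d \<otimes>\<^bsub>D\<^esub> e divides\<^bsub>D\<^esub> d' \<otimes>\<^bsub>D\<^esub> e"
    using Gcd_\<tau>_multiples[OF d'e] ae by simp
  then show ?thesis using d d' e by simp
qed

lemma extension_embedding: "semigroup_embedding D S extension"
proof -
  have "inj_on extension (carrier D)"
  proof (rule inj_onI)
    fix d d' assume d: "d \<in> carrier D" "d' \<in> carrier D" and eq: "extension d = extension d'"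
    have "d divides\<^bsub>D\<^esub> d'"
      by (rule divides_if_extension_divides[OF d]) (simp add: eq d)
    moreover have "d' divides\<^bsub>D\<^esub> d"
      by (rule divides_if_extension_divides[OF d(2,1)]) (simp add: eq d)
    ultimately show "d = d'"
      using d by (rule D.divides_antisymmetric)
  qed
  moreover have "extension \<one>\<^bsub>D\<^esub> = \<one>\<^bsub>S\<^esub>"
    using extension_\<tau>[of "\<one>\<^bsub>\<Gamma>\<^esub>"] \<tau>_one \<alpha>_one by simp
  ultimately show ?thesis
    unfolding semigroup_embedding_def mon_def hom_def by (auto simp: extension_mult)
qed

text \<open>Any solution \<open>\<beta>\<close> divides the constructed one pointwise, and the two have the same product on a pair
  of complementary divisors \<open>d\<close> and \<open>e\<close>; by cancellation they agree on \<open>d\<close>.\<close>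

lemma extension_unique:
  assumes hom: "\<beta> \<in> hom D S" and ext: "\<And>a. a \<in> carrier \<Gamma> \<Longrightarrow> \<beta> (\<tau> a) = \<alpha> a"
    and d: "d \<in> carrier D"
  shows "\<beta> d = extension d"
proof -
  have closed: "\<beta> c \<in> carrier S" if "c \<in> carrier D" for c
    using hom that by (auto simp: hom_def)
  have mult: "\<beta> (b \<otimes>\<^bsub>D\<^esub> c) = \<beta> b \<otimes>\<^bsub>S\<^esub> \<beta> c" if "b \<in> carrier D" "c \<in> carrier D" for b c
    using hom that by (auto simp: hom_def)
  have le: "\<beta> c divides\<^bsub>S\<^esub> extension c" if c: "c \<in> carrier D" for c
  proof -
    have "\<beta> c divides\<^bsub>S\<^esub> \<alpha> a" if ac: "a \<in> multiples c" for a
    proof -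
      have a: "a \<in> carrier \<Gamma>" using ac by (simp add: multiples_def)
      obtain b where b: "b \<in> carrier D" "\<tau> a = c \<otimes>\<^bsub>D\<^esub> b"
        using ac by (auto simp: multiples_def factor_def)
      have "\<alpha> a = \<beta> c \<otimes>\<^bsub>S\<^esub> \<beta> b" using ext[OF a] b mult[OF c] by simp
      then show ?thesis by (rule dividesI[OF closed[OF b(1)]])
    qed
    then show ?thesis
      unfolding extension_def using closed[OF c] multiples_nonempty[OF c]
      by (subst S.divides_Gcd_of_iff) (simp_all add: \<alpha>_image_subset multiples_subset)
  qed
  obtain a e where a: "a \<in> carrier \<Gamma>" and e: "e \<in> carrier D" and ae: "\<tau> a = d \<otimes>\<^bsub>D\<^esub> e"
    using complementary_divisor[OF d] .
  have "extension d \<otimes>\<^bsub>S\<^esub> extension e = \<beta> d \<otimes>\<^bsub>S\<^esub> \<beta> e"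
    using ext[OF a] extension_\<tau>[OF a] ae mult[OF d e] extension_mult[OF d e] by simp
  then have "extension d \<otimes>\<^bsub>S\<^esub> \<beta> e divides\<^bsub>S\<^esub> \<beta> d \<otimes>\<^bsub>S\<^esub> \<beta> e"
    using S.divides_mult_lI[OF le[OF e], of "extension d"] closed d e by simp
  then have "extension d divides\<^bsub>S\<^esub> \<beta> d"
    using closed d e by simp
  then show ?thesis
    using le[OF d] closed d by (intro S.divides_antisymmetric) auto
qed

end

theorem theorem7p3:
  fixes \<Gamma> :: "('g, 'm) monoid_scheme"
    and D :: "('d, 'n) monoid_scheme"
    and S :: "('s, 'k) monoid_scheme"
    and \<tau> :: "'g \<Rightarrow> 'd" and \<alpha> :: "'g \<Rightarrow> 's"
  assumes "reduced_semigroup \<Gamma>"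
    and "divisor_theory \<Gamma> D \<tau>"
    and "free_semigroup S"
    and "semigroup_embedding \<Gamma> S \<alpha>"
    and "reflects_quotients \<Gamma> S \<alpha>"
    and "\<And>A. A \<subseteq> carrier \<Gamma> \<Longrightarrow> coprime_in D (\<tau> ` A) \<Longrightarrow> coprime_in S (\<alpha> ` A)"
  shows "\<exists>!\<beta>. \<beta> \<in> extensional (carrier D) \<and> semigroup_embedding D S \<beta> \<and>
           (\<forall>a \<in> carrier \<Gamma>. \<beta> (\<tau> a) = \<alpha> a)"
proof -
  interpret \<Gamma>: reduced_semigroup \<Gamma> by fact
  interpret S: free_semigroup S by fact
  interpret D: free_semigroup D using assms(2) by (simp add: divisor_theory_def)
  have \<tau>: "semigroup_embedding \<Gamma> D \<tau>" "reflects_quotients \<Gamma> D \<tau>"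
    using assms(2) by (simp_all add: divisor_theory_def)
  interpret divisor_extension \<Gamma> D S \<tau> \<alpha>
  proof (unfold_locales; (fact assms \<tau>)?)
    fix d\<^sub>1 d\<^sub>2
    assume d: "d\<^sub>1 \<in> carrier D" "d\<^sub>2 \<in> carrier D"
      and eq: "\<And>a. a \<in> carrier \<Gamma> \<Longrightarrow> d\<^sub>1 divides\<^bsub>D\<^esub> \<tau> a \<longleftrightarrow> d\<^sub>2 divides\<^bsub>D\<^esub> \<tau> a"
    have dvd: "(\<exists>c \<in> carrier D. \<tau> a = c \<otimes>\<^bsub>D\<^esub> d) \<longleftrightarrow> d divides\<^bsub>D\<^esub> \<tau> a" if "d \<in> carrier D" for a d
      unfolding factor_def using that D.m_comm by metis
    have "{a \<in> carrier \<Gamma>. \<exists>d \<in> carrier D. \<tau> a = d \<otimes>\<^bsub>D\<^esub> d\<^sub>1} =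
          {b \<in> carrier \<Gamma>. \<exists>d \<in> carrier D. \<tau> b = d \<otimes>\<^bsub>D\<^esub> d\<^sub>2}"
      using d eq dvd by auto
    then show "d\<^sub>1 = d\<^sub>2" using assms(2) d unfolding divisor_theory_def by blast
  qed
  show ?thesis
  proof (rule ex1I, intro conjI ballI)
    let ?\<beta> = "restrict extension (carrier D)"
    show "?\<beta> \<in> extensional (carrier D)" by simp
    show "semigroup_embedding D S ?\<beta>"
      using extension_embedding
      unfolding semigroup_embedding_def mon_def hom_def inj_on_def by auto
    show "?\<beta> (\<tau> a) = \<alpha> a" if "a \<in> carrier \<Gamma>" for a
      using that extension_\<tau> by simp
  next
    fix \<beta>
    assume \<beta>: "\<beta> \<in> extensional (carrier D) \<and> semigroup_embedding D S \<beta> \<and>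
      (\<forall>a \<in> carrier \<Gamma>. \<beta> (\<tau> a) = \<alpha> a)"
    then have "\<beta> d = extension d" if "d \<in> carrier D" for d
      using that by (intro extension_unique) (auto simp: semigroup_embedding_def mon_def)
    then show "\<beta> = restrict extension (carrier D)"
      using \<beta> by (intro extensionalityI) auto
  qed
qed

end
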